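(* Let $X=(X_i)_{i\ge1}$ be a stationary process with values in a measurable space $E$, let $(\mathcal Y,\|\cdot\|)$ be a normed vector space, and for each $n\ge1$ let $S_n\Phi:E^{\mathbb N_+}\to\mathcal Y$ be measurable. Let $\mu_n$ be the distribution of $S_n\Phi(X)/n$. Let $(k(n))_{n\ge1}$ be an increasing sequence of positive integers and let $\mu_n^\omega$ be the empirical measures defined in the context. Assume: (i) $(\mu_n)_{n\ge1}$ satisfies in $\mathcal Y$ the large deviation principle (LDP) with rate function $I$; (ii) $M_h=\int_0^1(\alpha_X^{-1}(u))^h\,du<\infty$ for all $h>0$; (iii) there exists a sequence $(S_n\Phi_n)_{n\ge1}$ of measurable functions from $E^{\mathbb N_+}$ to $\mathcal Y$ such that each $S_n\Phi_n$ depends only on the first $2n$ coordinates and $\delta_n=\sup_{z\in E^{\mathbb N_+}}\|S_n\Phi(z)-S_n\Phi_n(z)\|/n\to0$ as $n\to\infty$. Then: (1) Let $x\in\mathcal D_I$. If $\liminf_{n\to\infty}\frac{\log k(n)}n>I(x)$ then, with probability 1, $$\lim_{\epsilon\to0^+}\liminf_{n\to\infty}\frac1n\log\mu_n^\omega(B(x,\epsilon))=\lim_{\epsilon\to0^+}\limsup_{n\to\infty}\frac1n\log\mu_n^\omega(B(x,\epsilon))=-I(x).$$ If $\limsup_{n\to\infty}\frac{\log k(n)}n<I(x)$ then there exists $\epsilon>0$ such that, with probability 1, for $n$ large enough the set $\{1\le j\le k(n): S_n\Phi(T^{(j-1)n}X(\omega))/n\in B(x,\epsilon)\}$ is empty.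 (2) Let $x\in\mathcal Y\setminus\mathcal D_I$. With probability 1, $\lim_{\epsilon\to0^+}\limsup_{n\to\infty}\frac1n\log\mu_n^\omega(B(x,\epsilon))=-I(x)=-\infty$. (3) If $(\mu_n)_{n\ge1}$ is exponentially tight, then almost surely so is $(\mu_n^\omega)_{n\ge1}$.
   Context: $\mathbb N_+$ is the set of positive integers; $X$ is defined on a probability space $(\Omega,\mathcal A,\mathbb P)$; $T(x_1,x_2,\dots)=(x_2,x_3,\dots)$ is the shift on $E^{\mathbb N_+}$. $\mathcal Y$ carries its completed Borel $\sigma$-field $B_{\mathcal Y}$; $B(x,r)$ is the closed ball of center $x$ and radius $r$. (In the paper $S_n\Phi(X)$ is a measurable function of $(X,TX,\dots,T^{n-1}X)$; a typical example is a Birkhoff sum $\sum_{j=0}^{n-1}\Phi(T^jX)$.) Mixing: for sub-$\sigma$-algebras $\mathcal U,\mathcal V$ of $\mathcal A$, $\alpha(\mathcal U,\mathcal V)=\sup\{|\mathbb P(U)\mathbb P(V)-\mathbb P(U\cap V)|:U\in\mathcal U,V\in\mathcal V\}$. Set $\alpha_{X,0}=1/2$ and, for $m\ge1$, $\alpha_{X,m}=\sup\{\alpha(\sigma(X_k:k\le i),\sigma(X_j:j\ge i+m)):i\ge1\}$. For $u\in[0,1]$, $\alpha_X^{-1}(u)=\inf\{m:\alpha_{X,m}\le u\}$. Empirical measures: $\mu_n^\omega=\frac1{k(n)}\sum_{j=1}^{k(n)}\delta_{x_{n,j}(\omega)}$ with $x_{n,j}(\omega)=S_n\Phi(T^{(j-1)n}X(\omega))/n$.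 LDP: for a lower semicontinuous $I:\mathcal Y\to[0,\infty]$, $\mathcal D_I=\{x:I(x)<\infty\}$, and $(\mu_n)$ satisfies the LDP with rate function $I$ if for all $\Gamma\in B_{\mathcal Y}$, $-\inf_{\mathring\Gamma}I\le\liminf_n\frac1n\log\mu_n(\Gamma)\le\limsup_n\frac1n\log\mu_n(\Gamma)\le-\inf_{\overline\Gamma}I$. A sequence $(\mu_n)$ is exponentially tight if for every $\alpha<\infty$ there is a compact $K_\alpha\subset\mathcal Y$ with $\limsup_n\frac1n\log\mu_n(K_\alpha^c)\le-\alpha$. *)

theory Defs
  imports "HOL-Probability.Probability"
begin

section \<open>Processes indexed by the positive integers\<close>

text \<open>Points of \<open>E\<^sup>\<nat>\<close>, with \<open>\<nat> = {1, 2, \<dots>}\<close>, are functions on \<open>nat\<close> that are undefined at \<open>0\<close>.\<close>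

definition seq_space :: "'e measure \<Rightarrow> (nat \<Rightarrow> 'e) measure" where
  "seq_space E = Pi\<^sub>M {1..} (\<lambda>_. E)"

definition shift :: "(nat \<Rightarrow> 'e) \<Rightarrow> (nat \<Rightarrow> 'e)" where
  "shift x = (\<lambda>i\<in>{1..}. x (Suc i))"

definition path :: "(nat \<Rightarrow> 'w \<Rightarrow> 'e) \<Rightarrow> 'w \<Rightarrow> (nat \<Rightarrow> 'e)" where
  "path X \<omega> = (\<lambda>i\<in>{1..}. X i \<omega>)"

definition stationary_process :: "'w measure \<Rightarrow> 'e measure \<Rightarrow> (nat \<Rightarrow> 'w \<Rightarrow> 'e) \<Rightarrow> bool" where
  "stationary_process P E X \<longleftrightarrow>
     (\<forall>i\<ge>1. X i \<in> measurable P E) \<and>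
     (\<forall>m. distr P (seq_space E) (\<lambda>\<omega>. (shift ^^ m) (path X \<omega>)) = distr P (seq_space E) (path X))"

section \<open>Strong mixing\<close>

definition alpha_coeff :: "'w measure \<Rightarrow> 'w set set \<Rightarrow> 'w set set \<Rightarrow> real" where
  "alpha_coeff P \<U> \<V> =
     (SUP (U, V) \<in> \<U> \<times> \<V>. \<bar>measure P U * measure P V - measure P (U \<inter> V)\<bar>)"

definition generated_sigma :: "'w measure \<Rightarrow> 'e measure \<Rightarrow> (nat \<Rightarrow> 'w \<Rightarrow> 'e) \<Rightarrow> nat set \<Rightarrow> 'w set set" where
  "generated_sigma P E X J =
     sigma_sets (space P) (\<Union>k\<in>J. {X k -` A \<inter> space P | A. A \<in> sets E})"

definition alpha_mix :: "'w measure \<Rightarrow> 'e measure \<Rightarrow> (nat \<Rightarrow> 'w \<Rightarrow> 'e) \<Rightarrow> nat \<Rightarrow> real" where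
  "alpha_mix P E X m =
     (if m = 0 then 1 / 2
      else (SUP i\<in>{1..}. alpha_coeff P (generated_sigma P E X {1..i}) (generated_sigma P E X {i + m..})))"

text \<open>The infimum is taken in \<open>enat\<close>, so that it is \<open>\<infinity>\<close> when no \<open>m\<close> qualifies.\<close>

definition alpha_inv :: "'w measure \<Rightarrow> 'e measure \<Rightarrow> (nat \<Rightarrow> 'w \<Rightarrow> 'e) \<Rightarrow> real \<Rightarrow> enat" where
  "alpha_inv P E X u = Inf {enat m | m. alpha_mix P E X m \<le> u}"

definition enat_powr :: "enat \<Rightarrow> real \<Rightarrow> ennreal" where
  "enat_powr q h = (case q of enat m \<Rightarrow> ennreal (real m powr h) | \<infinity> \<Rightarrow> \<infinity>)"

definition mixing_moment :: "'w measure \<Rightarrow> 'e measure \<Rightarrow> (nat \<Rightarrow> 'w \<Rightarrow> 'e) \<Rightarrow> real \<Rightarrow> ennreal" where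
  "mixing_moment P E X h = (\<integral>\<^sup>+u\<in>{0..1}. enat_powr (alpha_inv P E X u) h \<partial>lborel)"

section \<open>Large deviations\<close>

definition ext_ln :: "real \<Rightarrow> ereal" where
  "ext_ln p = (if p \<le> 0 then - \<infinity> else ereal (ln p))"

definition log_rate :: "(nat \<Rightarrow> 'y measure) \<Rightarrow> 'y set \<Rightarrow> nat \<Rightarrow> ereal" where
  "log_rate \<nu> \<Gamma> n = ereal (1 / real n) * ext_ln (measure (\<nu> n) \<Gamma>)"

text \<open>Lower semicontinuity is expressed by closedness of the sublevel sets.\<close>

definition rate_function :: "('y::topological_space \<Rightarrow> ereal) \<Rightarrow> bool" where
  "rate_function I \<longleftrightarrow> (\<forall>x. 0 \<le> I x) \<and> (\<forall>a. closed {x. I x \<le> a})"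

definition effective_domain :: "('y \<Rightarrow> ereal) \<Rightarrow> 'y set" where
  "effective_domain I = {x. I x < \<infinity>}"

text \<open>
  The completed Borel \<open>\<sigma>\<close>-field relative to \<open>(\<nu>\<^sub>n)\<close> consists of the sets that are measurable for the
  completion of every \<open>\<nu>\<^sub>n\<close>, \<open>n \<ge> 1\<close>, each \<open>\<nu>\<^sub>n\<close> being a Borel measure.
\<close>

definition completed_field :: "(nat \<Rightarrow> 'y measure) \<Rightarrow> 'y set set" where
  "completed_field \<nu> = (\<Inter>n\<in>{1..}. sets (completion (\<nu> n)))"

definition LDP :: "(nat \<Rightarrow> 'y::topological_space measure) \<Rightarrow> ('y \<Rightarrow> ereal) \<Rightarrow> bool" where
  "LDP \<nu> I \<longleftrightarrow> rate_function I \<and>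
     (\<forall>\<Gamma>\<in>completed_field \<nu>.
        - (INF x\<in>interior \<Gamma>. I x) \<le> liminf (log_rate (\<lambda>n. completion (\<nu> n)) \<Gamma>) \<and>
        liminf (log_rate (\<lambda>n. completion (\<nu> n)) \<Gamma>) \<le> limsup (log_rate (\<lambda>n. completion (\<nu> n)) \<Gamma>) \<and>
        limsup (log_rate (\<lambda>n. completion (\<nu> n)) \<Gamma>) \<le> - (INF x\<in>closure \<Gamma>. I x))"

definition exponentially_tight :: "(nat \<Rightarrow> 'y::topological_space measure) \<Rightarrow> bool" where
  "exponentially_tight \<nu> \<longleftrightarrow>
     (\<forall>\<alpha>::real. \<exists>K. compact K \<and> limsup (log_rate \<nu> (- K)) \<le> - ereal \<alpha>)"

section \<open>Distributions and empirical measures\<close>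

definition law :: "'w measure \<Rightarrow> (nat \<Rightarrow> 'w \<Rightarrow> 'e) \<Rightarrow> (nat \<Rightarrow> (nat \<Rightarrow> 'e) \<Rightarrow> 'y::real_normed_vector) \<Rightarrow>
    nat \<Rightarrow> 'y measure" where
  "law P X S n = distr P borel (\<lambda>\<omega>. S n (path X \<omega>) /\<^sub>R real n)"

definition block_value :: "(nat \<Rightarrow> 'w \<Rightarrow> 'e) \<Rightarrow> (nat \<Rightarrow> (nat \<Rightarrow> 'e) \<Rightarrow> 'y::real_normed_vector) \<Rightarrow>
    nat \<Rightarrow> nat \<Rightarrow> 'w \<Rightarrow> 'y" where
  "block_value X S n j \<omega> = S n ((shift ^^ ((j - 1) * n)) (path X \<omega>)) /\<^sub>R real n"

definition empirical :: "(nat \<Rightarrow> 'w \<Rightarrow> 'e) \<Rightarrow> (nat \<Rightarrow> (nat \<Rightarrow> 'e) \<Rightarrow> 'y::real_normed_vector) \<Rightarrow>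
    (nat \<Rightarrow> nat) \<Rightarrow> 'w \<Rightarrow> nat \<Rightarrow> 'y measure" where
  "empirical X S k \<omega> n = measure_of UNIV (sets borel)
     (\<lambda>A. (\<Sum>j = 1..k n. emeasure (return borel (block_value X S n j \<omega>)) A) / of_nat (k n))"

lemma sets_empirical [simp]: "sets (empirical X S k \<omega> n) = sets borel"
  unfolding empirical_def by (metis sets.sets_measure_of_eq space_borel)

lemma emeasure_empirical:
  fixes S :: "nat \<Rightarrow> (nat \<Rightarrow> 'e) \<Rightarrow> 'y::real_normed_vector"
  assumes "A \<in> sets borel"
  shows "emeasure (empirical X S k \<omega> n) A =
    (\<Sum>j = 1..k n. emeasure (return borel (block_value X S n j \<omega>)) A) / of_nat (k n)"
  unfolding empirical_def
proof (rule emeasure_measure_of_sigma)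
  show "sigma_algebra UNIV (sets (borel :: 'y measure))"
    using sets.sigma_algebra_axioms[of "borel :: 'y measure"] by simp
  show "countably_additive (sets borel)
    (\<lambda>A. (\<Sum>j = 1..k n. emeasure (return borel (block_value X S n j \<omega>)) A) / of_nat (k n))"
  proof (rule countably_additiveI)
    fix B :: "nat \<Rightarrow> 'y set"
    assume B: "range B \<subseteq> sets borel" "disjoint_family B"
    have "(\<Sum>i. (\<Sum>j = 1..k n. emeasure (return borel (block_value X S n j \<omega>)) (B i)) / of_nat (k n))
        = (\<Sum>j = 1..k n. \<Sum>i. emeasure (return borel (block_value X S n j \<omega>)) (B i)) / of_nat (k n)"
      by (simp add: divide_ennreal_def suminf_sum)
    also have "\<dots> = (\<Sum>j = 1..k n. emeasure (return borel (block_value X S n j \<omega>)) (\<Union>i. B i)) / of_nat (k n)"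
      using B by (subst suminf_emeasure) auto
    finally show "(\<Sum>i. (\<Sum>j = 1..k n. emeasure (return borel (block_value X S n j \<omega>)) (B i)) / of_nat (k n))
        = (\<Sum>j = 1..k n. emeasure (return borel (block_value X S n j \<omega>)) (\<Union>i. B i)) / of_nat (k n)" .
  qed
qed (use assms in \<open>auto simp: positive_def\<close>)

end

theory Submission
  imports Defs
begin

text \<open>
  By stationarity every block value has the law \<open>\<mu>\<^sub>n\<close>, so the number \<open>N\<^sub>n\<close> of block values in a set \<open>A\<close> has
  mean \<open>k(n) \<mu>\<^sub>n(A)\<close>. Everything follows from comparing \<open>N\<^sub>n\<close> with its mean, up to factors of arbitrarily small exponential rate,
  outside events whose probabilities decay exponentially; the Borel-Cantelli lemma then gives almost
  sure statements.

  \<^item> From above, Markov's inequality is enough (\<open>limsup_log_rate_empirical_le\<close>). Applied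
    to small balls, where lower semicontinuity bounds \<open>I\<close> from below, it gives the upper bound
    \<open>- I x\<close> for every \<open>x\<close>; applied to complements of compact sets it gives exponential tightness. If \<open>k(n)\<close> grows
    more slowly than \<open>e\<^sup>n\<^sup>I\<^sup>(\<^sup>x\<^sup>)\<close>, the mean itself tends to \<open>0\<close> exponentially, and there are eventually no visits
    (\<open>AE_eventually_no_visit\<close>).

  \<^item> From below, Chebyshev's inequality is used (\<open>few_occurrences_prob_le\<close>). Replacing \<open>S\<^sub>n\<Phi>\<close> by a
    function of \<open>2n\<close> coordinates makes the covariance of the visits at two blocks at most the mixing coefficient
    of the gap between their windows (\<open>block_covariance_le\<close>), and it is always at most the probability
    \<open>p\<close> of a visit. The moments \<open>M\<^sub>h\<close> make the mixing coefficients decay faster than any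
    power (\<open>alpha_mix_polynomial_decay\<close>), hence, at gaps of size \<open>e\<^sup>n\<^sup>\<eta>\<close>, faster than any prescribed
    exponential in \<open>n\<close>. The remaining near-diagonal pairs contribute about \<open>e\<^sup>n\<^sup>\<eta> / (k(n) p)\<close> to the
    probability of having too few visits, which is exponentially small when \<open>k(n)\<close> grows faster than \<open>e\<^sup>n\<^sup>I\<^sup>(\<^sup>x\<^sup>)\<close>
    and \<open>\<eta>\<close> is small (\<open>many_block_visits\<close>).
\<close>

section \<open>Exponential rates\<close>

lemma log_rate_le_iff:
  assumes "n \<ge> 1"
  shows "log_rate \<nu> \<Gamma> n \<le> ereal b \<longleftrightarrow> measure (\<nu> n) \<Gamma> \<le> exp (real n * b)"
proof (cases "measure (\<nu> n) \<Gamma> \<le> 0")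
  case True
  then show ?thesis
    using assms unfolding log_rate_def ext_ln_def
    by (auto intro: order_trans[OF _ exp_ge_zero])
next
  case False
  then have "measure (\<nu> n) \<Gamma> \<le> exp (real n * b) \<longleftrightarrow> ln (measure (\<nu> n) \<Gamma>) \<le> real n * b"
    by (metis exp_le_cancel_iff exp_ln not_le)
  then show ?thesis
    using False assms unfolding log_rate_def ext_ln_def
    by (auto simp: field_simps)
qed

lemma le_log_rate_iff:
  assumes "n \<ge> 1"
  shows "ereal a \<le> log_rate \<nu> \<Gamma> n \<longleftrightarrow> exp (real n * a) \<le> measure (\<nu> n) \<Gamma>"
proof (cases "measure (\<nu> n) \<Gamma> \<le> 0")
  case True
  then have "\<not> exp (real n * a) \<le> measure (\<nu> n) \<Gamma>"
    using exp_gt_zero[of "real n * a"] by linarith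
  then show ?thesis
    using assms True unfolding log_rate_def ext_ln_def by auto
next
  case False
  then have "exp (real n * a) \<le> measure (\<nu> n) \<Gamma> \<longleftrightarrow> real n * a \<le> ln (measure (\<nu> n) \<Gamma>)"
    by (metis exp_le_cancel_iff exp_ln not_le)
  then show ?thesis
    using False assms unfolding log_rate_def ext_ln_def
    by (auto simp: field_simps)
qed

lemma limsup_log_rate_leI:
  assumes "\<forall>\<^sub>F n in sequentially. measure (\<nu> n) \<Gamma> \<le> exp (real n * b)"
  shows "limsup (log_rate \<nu> \<Gamma>) \<le> ereal b"
  by (rule Limsup_bounded) (use assms eventually_ge_at_top[of 1] in \<open>eventually_elim, simp add: log_rate_le_iff\<close>)

lemma le_liminf_log_rateI:
  assumes "\<forall>\<^sub>F n in sequentially. exp (real n * a) \<le> measure (\<nu> n) \<Gamma>"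
  shows "ereal a \<le> liminf (log_rate \<nu> \<Gamma>)"
  by (rule Liminf_bounded) (use assms eventually_ge_at_top[of 1] in \<open>eventually_elim, simp add: le_log_rate_iff\<close>)

lemma limsup_log_rate_lessD:
  assumes "limsup (log_rate \<nu> \<Gamma>) < ereal b"
  shows "\<forall>\<^sub>F n in sequentially. measure (\<nu> n) \<Gamma> \<le> exp (real n * b)"
  using Limsup_lessD[OF assms] eventually_ge_at_top[of 1]
  by eventually_elim (simp add: log_rate_le_iff[symmetric])

lemma less_liminf_log_rateD:
  assumes "ereal a < liminf (log_rate \<nu> \<Gamma>)"
  shows "\<forall>\<^sub>F n in sequentially. exp (real n * a) \<le> measure (\<nu> n) \<Gamma>"
  using less_LiminfD[OF assms] eventually_ge_at_top[of 1]
  by eventually_elim (simp add: le_log_rate_iff[symmetric])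

lemma rate_function_cball:
  fixes I :: "'y::metric_space \<Rightarrow> ereal"
  assumes "rate_function I" and "ereal a < I x"
  obtains e where "e > 0" and "ereal a \<le> (INF y\<in>cball x e. I y)"
proof -
  have "closed {y. I y \<le> ereal a}" and "x \<in> - {y. I y \<le> ereal a}"
    using assms by (auto simp: rate_function_def)
  then obtain e where "e > 0" "cball x e \<subseteq> - {y. I y \<le> ereal a}"
    by (metis open_Compl open_contains_cball)
  moreover from this have "ereal a \<le> (INF y\<in>cball x e. I y)"
    by (intro INF_greatest) force
  ultimately show ?thesis using that by blast
qed

section \<open>Almost sure statements from exponentially small probabilities\<close>

lemma (in prob_space) AE_eventually_not_in_exp_small:
  assumes "c > 0"
    and "\<forall>\<^sub>F n in sequentially. A n \<in> events \<and> prob (A n) \<le> C * exp (- real n * c)"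
  shows "AE \<omega> in M. \<forall>\<^sub>F n in sequentially. \<omega> \<notin> A n"
proof -
  obtain N where N: "\<And>n. n \<ge> N \<Longrightarrow> A n \<in> events \<and> prob (A n) \<le> C * exp (- real n * c)"
    using assms(2) by (auto simp: eventually_sequentially)
  define A' where "A' n = (if n \<ge> N then A n else {})" for n
  have ev: "A' n \<in> events" for n
    using N by (auto simp: A'_def)
  have "summable (\<lambda>n. C * exp (- c) ^ n)"
    using \<open>c > 0\<close> by (intro summable_mult summable_geometric) auto
  moreover have "exp (- real n * c) = exp (- c) ^ n" for n
    by (simp add: exp_of_nat_mult[symmetric])
  ultimately have "summable (\<lambda>n. C * exp (- real n * c))"
    by simp
  then have "summable (\<lambda>n. prob (A' n))"
    by (rule summable_comparison_test'[where N = N]) (use N in \<open>auto simp: A'_def\<close>)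
  then have "AE \<omega> in M. \<forall>\<^sub>F n in sequentially. \<omega> \<in> space M - A' n"
    by (intro borel_cantelli_AE1) (auto simp: ev emeasure_eq_measure)
  then show ?thesis
  proof eventually_elim
    case (elim \<omega>)
    then show ?case
      using eventually_ge_at_top[of N] by eventually_elim (auto simp: A'_def)
  qed
qed

text \<open>
  The second moment method. The variance of the number of events that occur is a sum over pairs
  \<open>(i, j)\<close>. At most \<open>k (2m + 1)\<close> pairs lie within distance \<open>m\<close> of the diagonal, and each of these
  contributes at most \<open>p\<close>; the other pairs, at most \<open>k\<^sup>2\<close> in number, are nearly independent. The crude
  count of the latter is affordable because \<open>a\<close> will be made smaller than any prescribed exponential.
\<close>

lemma (in prob_space) few_occurrences_prob_le:
  fixes A :: "nat \<Rightarrow> 'a set"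
  assumes ev: "\<And>j. j \<in> {1..k} \<Longrightarrow> A j \<in> events"
    and p: "\<And>j. j \<in> {1..k} \<Longrightarrow> prob (A j) = p"
    and far: "\<And>i j. i \<in> {1..k} \<Longrightarrow> j \<in> {1..k} \<Longrightarrow> i + m < j \<Longrightarrow> prob (A i \<inter> A j) - p * p \<le> a"
    and "k \<ge> 1" "p > 0" "a \<ge> 0"
  shows "prob {\<omega> \<in> space M. (\<Sum>j = 1..k. indicat_real (A j) \<omega>) \<le> real k * p / 2}
    \<le> 4 * ((2 * real m + 1) / (real k * p) + a / p\<^sup>2)"
proof -
  let ?N = "\<lambda>\<omega>. \<Sum>j = 1..k. indicat_real (A j) \<omega>"
  have int1: "integrable M (indicat_real (A j))" if "j \<in> {1..k}" for j
    using ev[OF that] by (auto simp: emeasure_eq_measure)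
  have expN: "expectation ?N = real k * p"
    using ev p by (subst Bochner_Integration.integral_sum) (auto simp: int1)
  have sq: "?N \<omega> ^ 2 = (\<Sum>i = 1..k. \<Sum>j = 1..k. indicat_real (A i \<inter> A j) \<omega>)" for \<omega>
    by (simp add: power2_eq_square sum_product indicator_inter_arith)
  have intsq: "integrable M (\<lambda>\<omega>. ?N \<omega> ^ 2)"
    unfolding sq using ev by (intro Bochner_Integration.integrable_sum) (auto simp: emeasure_eq_measure)
  have intN: "integrable M ?N"
    by (intro Bochner_Integration.integrable_sum int1)
  have expsq: "expectation (\<lambda>\<omega>. ?N \<omega> ^ 2) = (\<Sum>i = 1..k. \<Sum>j = 1..k. prob (A i \<inter> A j))"
    unfolding sq using ev
    by (subst Bochner_Integration.integral_sum, force intro!: Bochner_Integration.integrable_sum simp: emeasure_eq_measure,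
        intro sum.cong refl, subst Bochner_Integration.integral_sum)
       (auto simp: emeasure_eq_measure)
  have near_card: "card {j \<in> {1..k}. i \<le> j + m \<and> j \<le> i + m} \<le> 2 * m + 1" for i
  proof -
    have "card {j \<in> {1..k}. i \<le> j + m \<and> j \<le> i + m} \<le> card {i - m..i + m}"
      by (intro card_mono) auto
    also have "\<dots> \<le> 2 * m + 1" by simp
    finally show ?thesis .
  qed
  have pair: "prob (A i \<inter> A j) - p * p \<le> (if i \<le> j + m \<and> j \<le> i + m then p else 0) + a"
    if "i \<in> {1..k}" "j \<in> {1..k}" for i j
  proof -
    have "prob (A i \<inter> A j) \<le> p"
      using finite_measure_mono[of "A i \<inter> A j" "A i"] ev p that by auto
    moreover have "prob (A i \<inter> A j) - p * p \<le> a" if "\<not> (i \<le> j + m \<and> j \<le> i + m)"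
      using far[of i j] far[of j i] that \<open>i \<in> _\<close> \<open>j \<in> _\<close> by (force simp: Int_commute not_le)
    ultimately show ?thesis
      using \<open>a \<ge> 0\<close> zero_le_square[of p] by (auto intro: order_trans[of _ "prob (A i \<inter> A j)"] add_increasing2)
  qed
  have "variance ?N = (\<Sum>i = 1..k. \<Sum>j = 1..k. prob (A i \<inter> A j) - p * p)"
    unfolding variance_eq[OF intN intsq] unfolding expN expsq
    by (simp add: sum_subtractf power2_eq_square)
  also have "\<dots> \<le> (\<Sum>i = 1..k. \<Sum>j = 1..k. (if i \<le> j + m \<and> j \<le> i + m then p else 0) + a)"
    by (intro sum_mono pair)
  also have "\<dots> = (\<Sum>i = 1..k. real (card {j \<in> {1..k}. i \<le> j + m \<and> j \<le> i + m}) * p + real k * a)"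
    by (intro sum.cong refl) (simp add: sum.distrib sum.If_cases Int_def)
  also have "\<dots> \<le> (\<Sum>i = 1..k. (2 * real m + 1) * p + real k * a)"
  proof (intro sum_mono add_mono mult_right_mono)
    fix i
    show "real (card {j \<in> {1..k}. i \<le> j + m \<and> j \<le> i + m}) \<le> 2 * real m + 1"
      using near_card[of i] by linarith
  qed (use \<open>p > 0\<close> \<open>a \<ge> 0\<close> in auto)
  also have "\<dots> = real k * ((2 * real m + 1) * p + real k * a)" by simp
  finally have var: "variance ?N \<le> real k * ((2 * real m + 1) * p + real k * a)" .
  have kp: "real k * p / 2 > 0" using \<open>k \<ge> 1\<close> \<open>p > 0\<close> by simp
  have "prob {\<omega> \<in> space M. ?N \<omega> \<le> real k * p / 2}
      \<le> prob {\<omega> \<in> space M. real k * p / 2 \<le> \<bar>?N \<omega> - expectation ?N\<bar>}"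
    unfolding expN
  proof (rule finite_measure_mono)
    have "real k * p / 2 \<le> \<bar>y - real k * p\<bar>" if "y \<le> real k * p / 2" for y
      using that by linarith
    then show "{\<omega> \<in> space M. ?N \<omega> \<le> real k * p / 2} \<subseteq> {\<omega> \<in> space M. real k * p / 2 \<le> \<bar>?N \<omega> - real k * p\<bar>}"
      by blast
    show "{\<omega> \<in> space M. real k * p / 2 \<le> \<bar>?N \<omega> - real k * p\<bar>} \<in> events"
      using borel_measurable_integrable[OF intN] by measurable
  qed
  also have "\<dots> \<le> variance ?N / (real k * p / 2)\<^sup>2"
    using intN intsq kp by (intro Chebyshev_inequality) auto
  also have "\<dots> \<le> real k * ((2 * real m + 1) * p + real k * a) / (real k * p / 2)\<^sup>2"
    using var by (intro divide_right_mono) auto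
  also have "\<dots> = 4 * ((2 * real m + 1) / (real k * p) + a / p\<^sup>2)"
    using \<open>k \<ge> 1\<close> \<open>p > 0\<close> by (simp add: field_simps power2_eq_square)
  finally show ?thesis .
qed

section \<open>Strong mixing coefficients\<close>

lemma generated_sigma_mono: "J \<subseteq> J' \<Longrightarrow> generated_sigma P E X J \<subseteq> generated_sigma P E X J'"
  unfolding generated_sigma_def by (intro sigma_sets_mono') auto

lemma empty_in_generated_sigma: "{} \<in> generated_sigma P E X J"
  unfolding generated_sigma_def by (rule sigma_sets.Empty)

context prob_space
begin

lemma abs_prob_product_diff_le_1: "\<bar>prob U * prob V - prob (U \<inter> V)\<bar> \<le> 1"
proof -
  have "0 \<le> prob U * prob V" "prob U * prob V \<le> 1"
    by (auto intro: mult_le_one)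
  then show ?thesis
    using prob_le_1[of "U \<inter> V"] measure_nonneg[of M "U \<inter> V"] by linarith
qed

lemma le_alpha_coeff:
  assumes "U \<in> \<U>" "V \<in> \<V>"
  shows "\<bar>prob U * prob V - prob (U \<inter> V)\<bar> \<le> alpha_coeff M \<U> \<V>"
  unfolding alpha_coeff_def
  by (rule cSUP_upper2[where x = "(U, V)"])
     (use assms abs_prob_product_diff_le_1 in \<open>auto intro!: bdd_aboveI[where M = 1]\<close>)

lemma alpha_coeff_le_1:
  assumes "\<U> \<noteq> {}" "\<V> \<noteq> {}"
  shows "alpha_coeff M \<U> \<V> \<le> 1"
  unfolding alpha_coeff_def
  by (rule cSUP_least) (use assms abs_prob_product_diff_le_1 in auto)

lemma alpha_coeff_mono:
  assumes "\<U> \<noteq> {}" "\<V> \<noteq> {}" "\<U> \<subseteq> \<U>'" "\<V> \<subseteq> \<V>'"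
  shows "alpha_coeff M \<U> \<V> \<le> alpha_coeff M \<U>' \<V>'"
proof -
  have "\<bar>prob U * prob V - prob (U \<inter> V)\<bar> \<le> alpha_coeff M \<U>' \<V>'" if "U \<in> \<U>" "V \<in> \<V>" for U V
    using le_alpha_coeff[of U \<U>' V \<V>'] assms that by auto
  then show ?thesis
    unfolding alpha_coeff_def[of M \<U> \<V>] using assms by (intro cSUP_least) auto
qed

lemma alpha_coeff_generated_le_1:
  "alpha_coeff M (generated_sigma M E X J) (generated_sigma M E X J') \<le> 1"
  using empty_in_generated_sigma by (intro alpha_coeff_le_1) blast+

lemma alpha_coeff_le_alpha_mix:
  assumes "m \<ge> 1" "i \<ge> 1"
  shows "alpha_coeff M (generated_sigma M E X {1..i}) (generated_sigma M E X {i + m..}) \<le> alpha_mix M E X m"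
  unfolding alpha_mix_def
  using assms alpha_coeff_generated_le_1
  by (auto intro!: cSUP_upper bdd_aboveI[where M = 1])

lemma alpha_mix_le_1: "alpha_mix M E X m \<le> 1"
  unfolding alpha_mix_def
  using alpha_coeff_generated_le_1 by (auto intro!: cSUP_least)

lemma alpha_mix_nonneg: "0 \<le> alpha_mix M E X m"
proof (cases "m = 0")
  case False
  have "0 \<le> \<bar>prob {} * prob {} - prob ({} \<inter> {})\<bar>" by simp
  also have "\<dots> \<le> alpha_coeff M (generated_sigma M E X {1..1}) (generated_sigma M E X {1 + m..})"
    by (intro le_alpha_coeff empty_in_generated_sigma)
  also have "\<dots> \<le> alpha_mix M E X m"
    using False by (intro alpha_coeff_le_alpha_mix) auto
  finally show ?thesis .
qed (simp add: alpha_mix_def)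

lemma alpha_mix_antimono:
  assumes "1 \<le> m" "m \<le> m'"
  shows "alpha_mix M E X m' \<le> alpha_mix M E X m"
proof -
  have "alpha_coeff M (generated_sigma M E X {1..i}) (generated_sigma M E X {i + m'..}) \<le> alpha_mix M E X m"
    if "i \<ge> 1" for i
  proof -
    have "alpha_coeff M (generated_sigma M E X {1..i}) (generated_sigma M E X {i + m'..})
       \<le> alpha_coeff M (generated_sigma M E X {1..i}) (generated_sigma M E X {i + m..})"
      using assms empty_in_generated_sigma
      by (intro alpha_coeff_mono generated_sigma_mono) (blast | force)+
    also have "\<dots> \<le> alpha_mix M E X m"
      using assms that by (intro alpha_coeff_le_alpha_mix) auto
    finally show ?thesis .
  qed
  then show ?thesis
    using assms by (auto simp: alpha_mix_def[of M E X m'] intro!: cSUP_least)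
qed

text \<open>
  If \<open>u\<close> is below both \<open>\<alpha>\<^sub>m\<close> and \<open>\<alpha>\<^sub>0 = 1/2\<close>, then by monotonicity none of \<open>\<alpha>\<^sub>0, \<dots>, \<alpha>\<^sub>m\<close> is at most \<open>u\<close>,
  so \<open>\<alpha>\<inverse> u > m\<close>. As \<open>\<alpha>\<^sub>m \<le> 1\<close>, this covers all \<open>u < \<alpha>\<^sub>m / 2\<close>, and hence \<open>M\<^sub>h \<ge> m\<^sup>h \<alpha>\<^sub>m / 2\<close>.
\<close>

lemma alpha_mix_polynomial_decay:
  assumes "h > 0" "mixing_moment M E X h < \<infinity>"
  obtains C where "C \<ge> 0" "\<And>m. m \<ge> 1 \<Longrightarrow> alpha_mix M E X m \<le> C * real m powr (- h)"
proof
  let ?C = "2 * enn2real (mixing_moment M E X h)"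
  show "?C \<ge> 0" by simp
  fix m :: nat assume m: "m \<ge> 1"
  let ?a = "alpha_mix M E X m"
  have "ennreal (real m powr h * (?a / 2)) = ennreal (real m powr h) * emeasure lborel {0..<?a / 2}"
    using alpha_mix_nonneg[of E X m] by (simp add: ennreal_mult[symmetric])
  also have "\<dots> = (\<integral>\<^sup>+u. ennreal (real m powr h) * indicator {0..<?a / 2} u \<partial>lborel)"
    by (simp add: nn_integral_cmult_indicator)
  also have "\<dots> \<le> mixing_moment M E X h"
    unfolding mixing_moment_def
  proof (rule nn_integral_mono)
    fix u :: real
    have "ennreal (real m powr h) \<le> enat_powr (alpha_inv M E X u) h" if u: "0 \<le> u" "u < ?a / 2"
    proof -
      have "enat m \<le> enat i" if "alpha_mix M E X i \<le> u" for i
      proof (rule ccontr)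
        assume "\<not> enat m \<le> enat i"
        then have "i < m" by simp
        have "u < alpha_mix M E X i"
        proof (cases "i = 0")
          case True
          then show ?thesis using u alpha_mix_le_1[of E X m] by (simp add: alpha_mix_def)
        next
          case False
          then have "?a \<le> alpha_mix M E X i"
            using \<open>i < m\<close> by (intro alpha_mix_antimono) auto
          then show ?thesis using u by linarith
        qed
        with that show False by simp
      qed
      then have "enat m \<le> alpha_inv M E X u"
        unfolding alpha_inv_def by (auto intro!: Inf_greatest)
      then show ?thesis
        using \<open>h > 0\<close> unfolding enat_powr_def
        by (auto split: enat.split intro!: ennreal_leI powr_mono2)
    qed
    moreover have "u \<le> 1" if "u < ?a / 2"
      using that alpha_mix_le_1[of E X m] by simp
    ultimately show "ennreal (real m powr h) * indicator {0..<?a / 2} u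
        \<le> enat_powr (alpha_inv M E X u) h * indicator {0..1} u"
      by (auto simp: indicator_def)
  qed
  finally have "real m powr h * (?a / 2) \<le> enn2real (mixing_moment M E X h)"
    using assms(2) alpha_mix_nonneg[of E X m]
    by (metis enn2real_ennreal enn2real_mono infinity_ennreal_def mult_nonneg_nonneg powr_ge_zero
        divide_nonneg_nonneg zero_le_numeral)
  then show "?a \<le> ?C * real m powr (- h)"
    using m by (simp add: powr_minus field_simps)
qed

end


section \<open>Shifts of a stationary process\<close>

locale stationary = prob_space P for P :: "'w measure" +
  fixes E :: "'e measure" and X :: "nat \<Rightarrow> 'w \<Rightarrow> 'e"
  assumes stationary: "stationary_process P E X"
begin

lemma measurable_X: "i \<ge> 1 \<Longrightarrow> X i \<in> measurable P E"
  using stationary by (simp add: stationary_process_def)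

lemma shift_path: "(shift ^^ d) (path X \<omega>) = (\<lambda>i\<in>{1..}. X (i + d) \<omega>)"
  by (induction d) (auto simp: path_def shift_def)

lemma measurable_shift_path: "(\<lambda>\<omega>. (shift ^^ d) (path X \<omega>)) \<in> measurable P (seq_space E)"
  unfolding shift_path seq_space_def
  by (intro measurable_restrict measurable_X) auto

lemma measurable_path: "path X \<in> measurable P (seq_space E)"
  using measurable_shift_path[of 0] by simp

lemma shift_path_in_space: "\<omega> \<in> space P \<Longrightarrow> (shift ^^ d) (path X \<omega>) \<in> space (seq_space E)"
  using measurable_space[OF measurable_shift_path] by blast

lemma seq_space_nonempty: "space (seq_space E) \<noteq> {}"
  using not_empty shift_path_in_space by blast

lemma shift_path_event:
  "D \<in> sets (seq_space E) \<Longrightarrow> {\<omega> \<in> space P. (shift ^^ d) (path X \<omega>) \<in> D} \<in> events"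
  using measurable_sets[OF measurable_shift_path, of D d] by (simp add: vimage_def Int_def conj_commute)

lemma prob_shift_path:
  assumes "D \<in> sets (seq_space E)"
  shows "prob {\<omega> \<in> space P. (shift ^^ d) (path X \<omega>) \<in> D} = prob {\<omega> \<in> space P. path X \<omega> \<in> D}"
proof -
  have "measure (distr P (seq_space E) (\<lambda>\<omega>. (shift ^^ d) (path X \<omega>))) D
      = measure (distr P (seq_space E) (path X)) D"
    using stationary by (simp add: stationary_process_def)
  then show ?thesis
    using assms
    by (simp add: measure_distr measurable_shift_path measurable_path vimage_def Int_def conj_commute)
qed

text \<open>
  Membership of the shifted path in \<open>D\<close> does not change when the coordinates beyond \<open>l\<close> are replaced by
  those of a fixed sequence \<open>z0\<close>; the modified path is measurable for the \<open>\<sigma>\<close>-field of a finite window.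
\<close>

lemma shift_path_event_window:
  assumes D: "D \<in> sets (seq_space E)"
    and dep: "\<And>z z'. z \<in> space (seq_space E) \<Longrightarrow> z' \<in> space (seq_space E) \<Longrightarrow>
      (\<forall>i\<in>{1..l}. z i = z' i) \<Longrightarrow> z \<in> D \<Longrightarrow> z' \<in> D"
  shows "{\<omega> \<in> space P. (shift ^^ d) (path X \<omega>) \<in> D} \<in> generated_sigma P E X {d + 1..d + l}"
proof -
  let ?G = "\<Union>k\<in>{d + 1..d + l}. {X k -` A \<inter> space P | A. A \<in> sets E}"
  define Q where "Q = sigma (space P) ?G"
  have G: "?G \<subseteq> Pow (space P)" by auto
  have Q: "space Q = space P" "sets Q = generated_sigma P E X {d + 1..d + l}"
    using G by (auto simp: Q_def generated_sigma_def space_measure_of sets_measure_of)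
  obtain z0 where z0: "z0 \<in> space (seq_space E)"
    using seq_space_nonempty by blast
  define g where "g \<omega> = (\<lambda>i\<in>{1..}. if i \<le> l then X (i + d) \<omega> else z0 i)" for \<omega>
  have "(\<lambda>\<omega>. if i \<le> l then X (i + d) \<omega> else z0 i) \<in> measurable Q E" if "i \<in> {1..}" for i
  proof (cases "i \<le> l")
    case True
    have "X (i + d) \<in> measurable Q E"
    proof (rule measurableI)
      fix \<omega> assume "\<omega> \<in> space Q"
      then show "X (i + d) \<omega> \<in> space E"
        using measurable_space[OF measurable_X[of "i + d"]] that Q by auto
    next
      fix A assume "A \<in> sets E"
      then show "X (i + d) -` A \<inter> space Q \<in> sets Q"
        unfolding Q generated_sigma_def using that True
        by (intro sigma_sets.Basic UN_I[of "i + d"]) auto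
    qed
    then show ?thesis using True by simp
  next
    case False
    have "z0 i \<in> space E"
      using z0 that by (auto simp: seq_space_def space_PiM)
    then show ?thesis using False by simp
  qed
  then have g: "g \<in> measurable Q (seq_space E)"
    unfolding g_def seq_space_def by (rule measurable_restrict)
  have "(shift ^^ d) (path X \<omega>) \<in> D \<longleftrightarrow> g \<omega> \<in> D" if "\<omega> \<in> space P" for \<omega>
  proof -
    have "\<forall>i\<in>{1..l}. (shift ^^ d) (path X \<omega>) i = g \<omega> i"
      by (auto simp: shift_path g_def)
    moreover have "g \<omega> \<in> space (seq_space E)"
      using measurable_space[OF g] that Q by auto
    ultimately show ?thesis
      using dep[of "(shift ^^ d) (path X \<omega>)" "g \<omega>"] dep[of "g \<omega>" "(shift ^^ d) (path X \<omega>)"]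
        shift_path_in_space[OF that] by auto
  qed
  then have "{\<omega> \<in> space P. (shift ^^ d) (path X \<omega>) \<in> D} = g -` D \<inter> space Q"
    using Q by auto
  then show ?thesis
    using measurable_sets[OF g D] Q by simp
qed

text \<open>
  Blocks of length \<open>n\<close> enter through windows of length \<open>2 n\<close>. If \<open>i + m < j\<close>, the windows of the \<open>i\<close>-th and
  the \<open>j\<close>-th block are separated by a gap of at least \<open>m\<close>, because
  \<open>(i + 1) n + m \<le> (i + m) n + 1 \<le> (j - 1) n + 1\<close>.
\<close>

lemma block_covariance_le:
  assumes D: "D \<in> sets (seq_space E)"
    and dep: "\<And>z z'. z \<in> space (seq_space E) \<Longrightarrow> z' \<in> space (seq_space E) \<Longrightarrow>
      (\<forall>i\<in>{1..2 * n}. z i = z' i) \<Longrightarrow> z \<in> D \<Longrightarrow> z' \<in> D"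
    and "n \<ge> 1" "m \<ge> 1" "i \<ge> 1" "i + m < j"
  shows "prob ({\<omega> \<in> space P. (shift ^^ ((i - 1) * n)) (path X \<omega>) \<in> D}
        \<inter> {\<omega> \<in> space P. (shift ^^ ((j - 1) * n)) (path X \<omega>) \<in> D})
      - prob {\<omega> \<in> space P. path X \<omega> \<in> D} * prob {\<omega> \<in> space P. path X \<omega> \<in> D} \<le> alpha_mix P E X m"
proof -
  let ?A = "\<lambda>j. {\<omega> \<in> space P. (shift ^^ ((j - 1) * n)) (path X \<omega>) \<in> D}"
  have window: "?A j \<in> generated_sigma P E X {(j - 1) * n + 1..(j - 1) * n + 2 * n}" for j
    using D dep by (rule shift_path_event_window)
  have "(i - 1) * n + 2 * n = (i + 1) * n"
    using \<open>i \<ge> 1\<close> by (cases i) (auto simp: algebra_simps)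
  moreover have "{(i - 1) * n + 1..(i - 1) * n + 2 * n} \<subseteq> {1..(i - 1) * n + 2 * n}"
    by auto
  ultimately have U: "?A i \<in> generated_sigma P E X {1..(i + 1) * n}"
    using window[of i] generated_sigma_mono by (metis (no_types, lifting) subsetD)
  have "(i + m) * n \<le> (j - 1) * n"
    using assms by (intro mult_right_mono) auto
  moreover have "n + m \<le> m * n + 1"
  proof -
    obtain n' m' where "n = Suc n'" "m = Suc m'"
      using \<open>n \<ge> 1\<close> \<open>m \<ge> 1\<close> by (metis not_one_le_zero nat.exhaust)
    then show ?thesis by simp
  qed
  ultimately have "(i + 1) * n + m \<le> (j - 1) * n + 1"
    by (simp add: algebra_simps)
  then have "{(j - 1) * n + 1..(j - 1) * n + 2 * n} \<subseteq> {(i + 1) * n + m..}"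
    by auto
  then have V: "?A j \<in> generated_sigma P E X {(i + 1) * n + m..}"
    using window[of j] generated_sigma_mono by blast
  have "\<bar>prob (?A i) * prob (?A j) - prob (?A i \<inter> ?A j)\<bar>
      \<le> alpha_coeff P (generated_sigma P E X {1..(i + 1) * n}) (generated_sigma P E X {(i + 1) * n + m..})"
    by (rule le_alpha_coeff[OF U V])
  also have "\<dots> \<le> alpha_mix P E X m"
    using assms by (intro alpha_coeff_le_alpha_mix) auto
  finally show ?thesis
    unfolding prob_shift_path[OF D] by linarith
qed

text \<open>
  With \<open>m\<close> about \<open>e\<^sup>n\<^sup>\<eta>\<close>, the two terms of the second moment bound are of order \<open>e\<^sup>n\<^sup>\<eta> / e\<^sup>2\<^sup>n\<^sup>\<eta>\<close> and
  \<open>m\<^sup>-\<^sup>h e\<^sup>2\<^sup>n\<^sup>r\<close>. The second one is \<open>e\<^sup>-\<^sup>n\<^sup>\<eta>\<close> as well if \<open>h \<eta> = 2 r + \<eta>\<close>: this is where moments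
  \<open>M\<^sub>h\<close> of arbitrarily high order are used.
\<close>

lemma many_block_visits:
  fixes D :: "nat \<Rightarrow> (nat \<Rightarrow> 'e) set"
  assumes D: "\<And>n. n \<ge> 1 \<Longrightarrow> D n \<in> sets (seq_space E)"
    and dep: "\<And>n z z'. n \<ge> 1 \<Longrightarrow> z \<in> space (seq_space E) \<Longrightarrow> z' \<in> space (seq_space E) \<Longrightarrow>
      (\<forall>i\<in>{1..2 * n}. z i = z' i) \<Longrightarrow> z \<in> D n \<Longrightarrow> z' \<in> D n"
    and moments: "\<And>h::real. h > 0 \<Longrightarrow> mixing_moment P E X h < \<infinity>"
    and "r \<ge> 0" "\<eta> > 0"
    and p: "\<forall>\<^sub>F n in sequentially. exp (- real n * r) \<le> prob {\<omega> \<in> space P. path X \<omega> \<in> D n}"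
    and k: "\<forall>\<^sub>F n in sequentially. exp (real n * (r + 2 * \<eta>)) \<le> real (k n)"
  shows "AE \<omega> in P. \<forall>\<^sub>F n in sequentially.
    real (k n) * exp (- real n * r) / 2
      \<le> (\<Sum>j = 1..k n. indicat_real (D n) ((shift ^^ ((j - 1) * n)) (path X \<omega>)))"
proof -
  let ?A = "\<lambda>n j. {\<omega> \<in> space P. (shift ^^ ((j - 1) * n)) (path X \<omega>) \<in> D n}"
  let ?p = "\<lambda>n. prob {\<omega> \<in> space P. path X \<omega> \<in> D n}"
  let ?few = "\<lambda>n. {\<omega> \<in> space P. (\<Sum>j = 1..k n. indicat_real (?A n j) \<omega>) \<le> real (k n) * ?p n / 2}"
  define h where "h = (2 * r + \<eta>) / \<eta>"
  have "h > 0" using \<open>r \<ge> 0\<close> \<open>\<eta> > 0\<close> by (simp add: h_def)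
  obtain C where C: "C \<ge> 0" "\<And>m. m \<ge> 1 \<Longrightarrow> alpha_mix P E X m \<le> C * real m powr (- h)"
    using alpha_mix_polynomial_decay[OF \<open>h > 0\<close> moments[OF \<open>h > 0\<close>]] by blast
  have "\<forall>\<^sub>F n in sequentially. ?few n \<in> events \<and> prob (?few n) \<le> (20 + 4 * C) * exp (- real n * \<eta>)"
    using p k eventually_ge_at_top[of 1]
  proof eventually_elim
    case (elim n)
    define m where "m = nat \<lceil>exp (real n * \<eta>)\<rceil>"
    have x1: "exp (real n * \<eta>) \<ge> 1" using \<open>\<eta> > 0\<close> by simp
    have m: "exp (real n * \<eta>) \<le> real m" "real m \<le> 2 * exp (real n * \<eta>)"
      using x1 unfolding m_def by linarith+
    then have "m \<ge> 1" using x1 by linarith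
    have p0: "?p n > 0" using elim(1) exp_gt_zero[of "- real n * r"] by linarith
    have "real (k n) > 0" using elim(2) exp_gt_zero[of "real n * (r + 2 * \<eta>)"] by linarith
    then have k1: "k n \<ge> 1" by simp
    have A: "?A n j \<in> events" for j
      using D[OF elim(3)] by (rule shift_path_event)
    have few: "prob (?few n) \<le> 4 * ((2 * real m + 1) / (real (k n) * ?p n) + alpha_mix P E X m / (?p n)\<^sup>2)"
    proof (rule few_occurrences_prob_le)
      show "prob (?A n j) = ?p n" for j
        using D[OF elim(3)] by (rule prob_shift_path)
      show "prob (?A n i \<inter> ?A n j) - ?p n * ?p n \<le> alpha_mix P E X m"
        if "i \<in> {1..k n}" "i + m < j" for i j
        by (rule block_covariance_le[OF D[OF elim(3)] dep[OF elim(3)] elim(3) \<open>m \<ge> 1\<close>])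
          (use that in auto)
    qed (use A k1 p0 alpha_mix_nonneg in auto)
    have near: "(2 * real m + 1) / (real (k n) * ?p n) \<le> 5 * exp (- real n * \<eta>)"
    proof -
      have "exp (real n * (r + 2 * \<eta>)) * exp (- real n * r) \<le> real (k n) * ?p n"
        using elim by (intro mult_mono) auto
      then have kp: "exp (2 * (real n * \<eta>)) \<le> real (k n) * ?p n"
        by (simp add: exp_add[symmetric] algebra_simps)
      have "(2 * real m + 1) / (real (k n) * ?p n) \<le> (5 * exp (real n * \<eta>)) / exp (2 * (real n * \<eta>))"
      proof (rule frac_le)
        show "2 * real m + 1 \<le> 5 * exp (real n * \<eta>)" using m x1 by linarith
      qed (use kp in auto)
      also have "\<dots> = 5 * (exp (real n * \<eta>) / exp (2 * (real n * \<eta>)))"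
        by simp
      also have "\<dots> = 5 * exp (- real n * \<eta>)"
        unfolding exp_diff[symmetric] by simp
      finally show ?thesis .
    qed
    have far: "alpha_mix P E X m / (?p n)\<^sup>2 \<le> C * exp (- real n * \<eta>)"
    proof -
      have "real m powr (- h) \<le> exp (real n * \<eta>) powr (- h)"
        using m \<open>h > 0\<close> by (intro powr_mono2') auto
      also have "\<dots> = exp (- real n * (2 * r + \<eta>))"
        using \<open>\<eta> > 0\<close> by (simp add: powr_def h_def)
      finally have "alpha_mix P E X m \<le> C * exp (- real n * (2 * r + \<eta>))"
        using C(2)[OF \<open>m \<ge> 1\<close>] mult_left_mono[OF _ C(1)] by fastforce
      moreover have "exp (- 2 * (real n * r)) \<le> (?p n)\<^sup>2"
        using power_mono[OF elim(1), of 2] by (simp add: exp_double[symmetric] algebra_simps)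
      ultimately have "alpha_mix P E X m / (?p n)\<^sup>2 \<le> (C * exp (- real n * (2 * r + \<eta>))) / exp (- 2 * (real n * r))"
        using C(1) by (intro frac_le) auto
      also have "\<dots> = C * (exp (- real n * (2 * r + \<eta>)) / exp (- 2 * (real n * r)))"
        by simp
      also have "\<dots> = C * exp (- real n * \<eta>)"
        unfolding exp_diff[symmetric] by (simp add: algebra_simps)
      finally show ?thesis .
    qed
    have "prob (?few n) \<le> 4 * (5 * exp (- real n * \<eta>) + C * exp (- real n * \<eta>))"
      by (rule order_trans[OF few]) (intro mult_left_mono add_mono near far, simp)
    also have "\<dots> = (20 + 4 * C) * exp (- real n * \<eta>)"
      by (simp add: distrib_right distrib_left)
    finally have "prob (?few n) \<le> (20 + 4 * C) * exp (- real n * \<eta>)" .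
    moreover have "(\<lambda>\<omega>. \<Sum>j = 1..k n. indicat_real (?A n j) \<omega>) \<in> borel_measurable P"
      using A by (intro borel_measurable_sum borel_measurable_indicator)
    then have "?few n \<in> events"
      by measurable
    ultimately show ?case by blast
  qed
  then have "AE \<omega> in P. \<forall>\<^sub>F n in sequentially. \<omega> \<notin> ?few n"
    by (rule AE_eventually_not_in_exp_small[OF \<open>\<eta> > 0\<close>])
  then show ?thesis
    using AE_space
  proof eventually_elim
    case (elim \<omega>)
    show ?case
      using elim(1) p
    proof eventually_elim
      case (elim n)
      have "real (k n) * exp (- real n * r) / 2 \<le> real (k n) * ?p n / 2"
        using elim by (intro divide_right_mono mult_left_mono) auto
      also have "\<dots> \<le> (\<Sum>j = 1..k n. indicat_real (?A n j) \<omega>)"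
        using elim \<open>\<omega> \<in> space P\<close> by auto
      also have "\<dots> = (\<Sum>j = 1..k n. indicat_real (D n) ((shift ^^ ((j - 1) * n)) (path X \<omega>)))"
        using \<open>\<omega> \<in> space P\<close> by (simp add: indicator_def)
      finally show ?case .
    qed
  qed
qed

end

section \<open>Empirical measures of the blocks\<close>

lemma measure_empirical:
  fixes S :: "nat \<Rightarrow> (nat \<Rightarrow> 'e) \<Rightarrow> 'y::real_normed_vector"
  assumes "A \<in> sets borel" "k n \<ge> 1"
  shows "measure (empirical X S k \<omega> n) A
    = (\<Sum>j = 1..k n. indicat_real A (block_value X S n j \<omega>)) / real (k n)"
proof -
  have "(\<Sum>j = 1..k n. emeasure (return borel (block_value X S n j \<omega>)) A)
      = ennreal (\<Sum>j = 1..k n. indicat_real A (block_value X S n j \<omega>))"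
    using assms(1) by (simp add: sum_ennreal[symmetric] ennreal_indicator)
  then have "emeasure (empirical X S k \<omega> n) A
      = ennreal ((\<Sum>j = 1..k n. indicat_real A (block_value X S n j \<omega>)) / real (k n))"
    using assms by (simp add: emeasure_empirical divide_ennreal ennreal_of_nat_eq_real_of_nat sum_nonneg)
  then show ?thesis
    by (simp add: measure_def sum_nonneg)
qed

lemma log_rate_empirical_mono:
  fixes S :: "nat \<Rightarrow> (nat \<Rightarrow> 'e) \<Rightarrow> 'y::real_normed_vector"
  assumes "A \<in> sets borel" "B \<in> sets borel" "A \<subseteq> B" "k n \<ge> 1"
  shows "log_rate (empirical X S k \<omega>) A n \<le> log_rate (empirical X S k \<omega>) B n"
proof -
  have "measure (empirical X S k \<omega> n) A \<le> measure (empirical X S k \<omega> n) B"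
    unfolding measure_empirical[where k = k and n = n, OF assms(1,4)]
      measure_empirical[where k = k and n = n, OF assms(2,4)]
    using assms by (intro divide_right_mono sum_mono) (auto simp: indicator_def)
  then have "ext_ln (measure (empirical X S k \<omega> n) A) \<le> ext_ln (measure (empirical X S k \<omega> n) B)"
    by (auto simp: ext_ln_def)
  then show ?thesis
    unfolding log_rate_def by (intro ereal_mult_left_mono) auto
qed

lemma eventually_ge_1_imp:
  assumes "\<And>n::nat. n \<ge> 1 \<Longrightarrow> Q n"
  shows "\<forall>\<^sub>F n in sequentially. Q n"
  using eventually_ge_at_top[of 1] by eventually_elim (rule assms)

locale stationary_blocks = stationary P E X
  for P :: "'w measure" and E :: "'e measure" and X :: "nat \<Rightarrow> 'w \<Rightarrow> 'e" +
  fixes S :: "nat \<Rightarrow> (nat \<Rightarrow> 'e) \<Rightarrow> 'y::real_normed_vector" and k :: "nat \<Rightarrow> nat"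
  assumes measurable_S: "\<And>n. n \<ge> 1 \<Longrightarrow> S n \<in> measurable (seq_space E) borel"
    and k_ge_1: "\<And>n. n \<ge> 1 \<Longrightarrow> k n \<ge> 1"
begin

lemma visit_set_sets:
  assumes "n \<ge> 1" "A \<in> sets borel"
  shows "{z \<in> space (seq_space E). S n z /\<^sub>R real n \<in> A} \<in> sets (seq_space E)"
proof -
  have "(\<lambda>z. S n z /\<^sub>R real n) \<in> measurable (seq_space E) borel"
    using measurable_S[OF assms(1)] by measurable
  from measurable_sets[OF this assms(2)] show ?thesis
    by (simp add: vimage_def Int_def conj_commute)
qed

lemma block_event_eq:
  "{\<omega> \<in> space P. block_value X S n j \<omega> \<in> A}
    = {\<omega> \<in> space P. (shift ^^ ((j - 1) * n)) (path X \<omega>) \<in> {z \<in> space (seq_space E). S n z /\<^sub>R real n \<in> A}}"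
  using shift_path_in_space by (auto simp: block_value_def)

lemma block_event:
  assumes "n \<ge> 1" "A \<in> sets borel"
  shows "{\<omega> \<in> space P. block_value X S n j \<omega> \<in> A} \<in> events"
  unfolding block_event_eq by (intro shift_path_event visit_set_sets assms)

lemma measure_law:
  assumes "n \<ge> 1" "A \<in> sets borel"
  shows "measure (law P X S n) A
    = prob {\<omega> \<in> space P. path X \<omega> \<in> {z \<in> space (seq_space E). S n z /\<^sub>R real n \<in> A}}"
proof -
  have "(\<lambda>\<omega>. S n (path X \<omega>) /\<^sub>R real n) \<in> measurable P borel"
    using measurable_S[OF assms(1)] measurable_path by measurable
  moreover have "(\<lambda>\<omega>. S n (path X \<omega>) /\<^sub>R real n) -` A \<inter> space P
      = {\<omega> \<in> space P. path X \<omega> \<in> {z \<in> space (seq_space E). S n z /\<^sub>R real n \<in> A}}"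
    using shift_path_in_space[of _ 0] by auto
  ultimately show ?thesis
    using assms(2) by (simp add: law_def measure_distr)
qed

lemma prob_block_event:
  assumes "n \<ge> 1" "A \<in> sets borel"
  shows "prob {\<omega> \<in> space P. block_value X S n j \<omega> \<in> A} = measure (law P X S n) A"
  unfolding block_event_eq measure_law[OF assms]
  by (rule prob_shift_path[OF visit_set_sets[OF assms]])

text \<open>
  By stationarity the law is the mean of the empirical measure, so by Markov's inequality the
  empirical mass exceeds its mean by an exponential factor only with summable probabilities.
\<close>

lemma limsup_log_rate_empirical_le:
  assumes A: "A \<in> sets borel" and "limsup (log_rate (law P X S) A) < ereal b"
  shows "AE \<omega> in P. limsup (log_rate (empirical X S k \<omega>) A) \<le> ereal b"
proof -
  obtain c where "limsup (log_rate (law P X S) A) < ereal c" "c < b"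
    using ereal_dense2[OF assms(2)] by auto
  note law_le = limsup_log_rate_lessD[OF this(1)]
  define f where "f n \<omega> = (\<Sum>j = 1..k n. indicat_real {\<omega> \<in> space P. block_value X S n j \<omega> \<in> A} \<omega>) / real (k n)" for n \<omega>
  have f: "measure (empirical X S k \<omega> n) A = f n \<omega>" if "n \<ge> 1" "\<omega> \<in> space P" for n \<omega>
    using that A k_ge_1 by (simp add: measure_empirical f_def indicator_def)
  have "\<forall>\<^sub>F n in sequentially. {\<omega> \<in> space P. exp (real n * b) \<le> f n \<omega>} \<in> events \<and>
      prob {\<omega> \<in> space P. exp (real n * b) \<le> f n \<omega>} \<le> 1 * exp (- real n * (b - c))"
    using law_le eventually_ge_at_top[of 1]
  proof eventually_elim
    case (elim n)
    note ev = block_event[OF elim(2) A]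
    have int: "integrable P (f n)"
      unfolding f_def using ev
      by (intro integrable_divide Bochner_Integration.integrable_sum) (auto simp: emeasure_eq_measure)
    have "expectation (f n) = (\<Sum>j = 1..k n. measure (law P X S n) A) / real (k n)"
      unfolding f_def using ev prob_block_event[OF elim(2) A]
      by (subst integral_divide_zero, subst Bochner_Integration.integral_sum) (auto simp: emeasure_eq_measure)
    also have "\<dots> = measure (law P X S n) A"
      using k_ge_1[OF elim(2)] by simp
    finally have mean: "expectation (f n) = measure (law P X S n) A" .
    have "prob {\<omega> \<in> space P. exp (real n * b) \<le> f n \<omega>} \<le> expectation (f n) / exp (real n * b)"
      by (intro integral_Markov_inequality_measure[OF int, where A = "{}"])
        (auto simp: f_def intro!: divide_nonneg_nonneg sum_nonneg)
    also have "\<dots> \<le> exp (real n * c) / exp (real n * b)"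
      using elim(1) mean by (intro divide_right_mono) auto
    also have "\<dots> = 1 * exp (- real n * (b - c))"
      by (simp add: exp_diff[symmetric] algebra_simps)
    finally show ?case
      using borel_measurable_integrable[OF int] by (auto intro!: borel_measurable_le)
  qed
  then have "AE \<omega> in P. \<forall>\<^sub>F n in sequentially. \<omega> \<notin> {\<omega> \<in> space P. exp (real n * b) \<le> f n \<omega>}"
    using \<open>c < b\<close> by (intro AE_eventually_not_in_exp_small[where c = "b - c" and C = 1]) auto
  then show ?thesis
    using AE_space
  proof eventually_elim
    case (elim \<omega>)
    have "\<forall>\<^sub>F n in sequentially. measure (empirical X S k \<omega> n) A \<le> exp (real n * b)"
      using elim(1) eventually_ge_at_top[of 1] by eventually_elim (use elim(2) f in auto)
    then show ?case by (rule limsup_log_rate_leI)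
  qed
qed

text \<open>
  The block values of \<open>S n\<close> are compared with those of \<open>R n\<close>: eventually \<open>S n / n \<in> cball x d\<close> forces
  \<open>R n / n \<in> cball x ((d + e) / 2)\<close>, which in turn forces \<open>S n / n \<in> cball x e\<close>. The intermediate
  event depends on \<open>2 n\<close> coordinates only, so its visits can be counted by the second moment method.
\<close>

lemma liminf_log_rate_empirical_ge:
  fixes R :: "nat \<Rightarrow> (nat \<Rightarrow> 'e) \<Rightarrow> 'y"
  assumes moments: "\<And>h::real. h > 0 \<Longrightarrow> mixing_moment P E X h < \<infinity>"
    and R: "\<And>n. n \<ge> 1 \<Longrightarrow> R n \<in> measurable (seq_space E) borel"
    and R_dep: "\<And>n z z'. n \<ge> 1 \<Longrightarrow> z \<in> space (seq_space E) \<Longrightarrow> z' \<in> space (seq_space E) \<Longrightarrow>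
      (\<forall>i\<in>{1..2 * n}. z i = z' i) \<Longrightarrow> R n z = R n z'"
    and approx: "(\<lambda>n. SUP z\<in>space (seq_space E). ereal (norm (S n z - R n z) / real n)) \<longlonglongrightarrow> 0"
    and "d < e" "0 \<le> r" "r < s"
    and law: "ereal (- r) < liminf (log_rate (law P X S) (cball x d))"
    and k: "ereal r < liminf (\<lambda>n. ereal (ln (real (k n)) / real n))"
  shows "AE \<omega> in P. ereal (- s) \<le> liminf (log_rate (empirical X S k \<omega>) (cball x e))"
proof -
  define c where "c = (d + e) / 2"
  define D where "D n = {z \<in> space (seq_space E). R n z /\<^sub>R real n \<in> cball x c}" for n
  interpret R: stationary_blocks P E X R k
    by unfold_locales (use R k_ge_1 in auto)
  have "\<forall>\<^sub>F n in sequentially. (SUP z\<in>space (seq_space E). ereal (norm (S n z - R n z) / real n)) < ereal ((e - d) / 2)"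
    using approx \<open>d < e\<close> by (intro order_tendstoD(2)) (auto simp: zero_ereal_def)
  then have close: "\<forall>\<^sub>F n in sequentially. \<forall>z\<in>space (seq_space E).
      dist (S n z /\<^sub>R real n) (R n z /\<^sub>R real n) \<le> (e - d) / 2"
  proof eventually_elim
    case (elim n)
    show ?case
    proof
      fix z assume "z \<in> space (seq_space E)"
      then have "ereal (norm (S n z - R n z) / real n)
          \<le> (SUP z\<in>space (seq_space E). ereal (norm (S n z - R n z) / real n))"
        by (rule SUP_upper)
      then have "ereal (norm (S n z - R n z) / real n) < ereal ((e - d) / 2)"
        using elim by (rule order.strict_trans1)
      moreover have "dist (S n z /\<^sub>R real n) (R n z /\<^sub>R real n) = norm (S n z - R n z) / real n"
        unfolding dist_norm scaleR_diff_right[symmetric] norm_scaleR by (simp add: field_simps)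
      ultimately show "dist (S n z /\<^sub>R real n) (R n z /\<^sub>R real n) \<le> (e - d) / 2"
        by simp
    qed
  qed
  obtain t where t: "r < t" "ereal t < liminf (\<lambda>n. ereal (ln (real (k n)) / real n))"
    using ereal_dense2[OF k] by auto
  define \<eta> where "\<eta> = (t - r) / 2"
  have "\<eta> > 0" "t = r + 2 * \<eta>" using t by (auto simp: \<eta>_def field_simps)
  have kn: "\<forall>\<^sub>F n in sequentially. exp (real n * (r + 2 * \<eta>)) \<le> real (k n)"
    using less_LiminfD[OF t(2)] eventually_ge_at_top[of 1]
  proof eventually_elim
    case (elim n)
    then have "real n * t \<le> ln (real (k n))"
      by (simp add: field_simps)
    then have "real n * (r + 2 * \<eta>) \<le> ln (real (k n))"
      using \<open>t = r + 2 * \<eta>\<close> by simp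
    then show ?case
      using k_ge_1[OF elim(2)] by (simp add: ln_ge_iff)
  qed
  have visits: "\<forall>\<^sub>F n in sequentially. exp (- real n * r) \<le> prob {\<omega> \<in> space P. path X \<omega> \<in> D n}"
    using less_liminf_log_rateD[OF law] close eventually_ge_at_top[of 1]
  proof eventually_elim
    case (elim n)
    have "measure (law P X S n) (cball x d) \<le> prob {\<omega> \<in> space P. path X \<omega> \<in> D n}"
      unfolding measure_law[OF elim(3) borel_closed[OF closed_cball]]
    proof (rule finite_measure_mono)
      show "{\<omega> \<in> space P. path X \<omega> \<in> D n} \<in> events"
        using shift_path_event[of "D n" 0] R.visit_set_sets[OF elim(3), of "cball x c"] by (simp add: D_def)
      have "R n z /\<^sub>R real n \<in> cball x c" if "z \<in> space (seq_space E)" "S n z /\<^sub>R real n \<in> cball x d" for z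
        using elim(2) that dist_triangle[of x "R n z /\<^sub>R real n" "S n z /\<^sub>R real n"]
        by (auto simp: c_def field_simps)
      then show "{\<omega> \<in> space P. path X \<omega> \<in> {z \<in> space (seq_space E). S n z /\<^sub>R real n \<in> cball x d}}
          \<subseteq> {\<omega> \<in> space P. path X \<omega> \<in> D n}"
        by (auto simp: D_def)
    qed
    with elim(1) show ?case by simp
  qed
  have "AE \<omega> in P. \<forall>\<^sub>F n in sequentially. real (k n) * exp (- real n * r) / 2
      \<le> (\<Sum>j = 1..k n. indicat_real (D n) ((shift ^^ ((j - 1) * n)) (path X \<omega>)))"
  proof (rule many_block_visits)
    show "\<forall>\<^sub>F n in sequentially. exp (real n * (r + 2 * \<eta>)) \<le> real (k n)" by (rule kn)
    show "D n \<in> sets (seq_space E)" if "n \<ge> 1" for n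
      using that unfolding D_def by (intro R.visit_set_sets) auto
    show "z' \<in> D n" if "n \<ge> 1" "z \<in> space (seq_space E)" "z' \<in> space (seq_space E)"
      "\<forall>i\<in>{1..2 * n}. z i = z' i" "z \<in> D n" for n z z'
      using R_dep[OF that(1-4)] that(3,5) by (simp add: D_def)
  qed (fact moments \<open>\<eta> > 0\<close> \<open>0 \<le> r\<close> visits)+
  then show ?thesis
    using AE_space
  proof eventually_elim
    case (elim \<omega>)
    \<comment> \<open>The factor \<open>1/2\<close> lost in counting visits is absorbed by passing from the rate \<open>r\<close> to \<open>s\<close>.\<close>
    have large: "\<forall>\<^sub>F n in sequentially. ln 2 \<le> real n * (s - r)"
      using eventually_ge_at_top[of "nat \<lceil>ln 2 / (s - r)\<rceil>"]
    proof eventually_elim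
      case (elim n)
      then have "ln 2 / (s - r) \<le> real n" by linarith
      then show ?case using \<open>r < s\<close> by (simp add: field_simps)
    qed
    have "\<forall>\<^sub>F n in sequentially. exp (real n * (- s)) \<le> measure (empirical X S k \<omega> n) (cball x e)"
      using elim(1) close large eventually_ge_at_top[of 1]
    proof eventually_elim
      case (elim n)
      have kpos: "real (k n) > 0" using k_ge_1[OF elim(4)] by simp
      have sub: "indicat_real (D n) ((shift ^^ ((j - 1) * n)) (path X \<omega>))
          \<le> indicat_real (cball x e) (block_value X S n j \<omega>)" for j
      proof -
        have "S n z /\<^sub>R real n \<in> cball x e" if "z \<in> D n" for z
          using elim(2) that dist_triangle[of x "S n z /\<^sub>R real n" "R n z /\<^sub>R real n"]
          by (auto simp: D_def c_def dist_commute field_simps)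
        then show ?thesis by (auto simp: indicator_def block_value_def)
      qed
      have "exp (real n * (- s)) \<le> exp (- real n * r - ln 2)"
        using elim(3) by (simp add: algebra_simps)
      also have "\<dots> = exp (- real n * r) / 2"
        by (simp add: exp_diff)
      also have "\<dots> \<le> (\<Sum>j = 1..k n. indicat_real (D n) ((shift ^^ ((j - 1) * n)) (path X \<omega>))) / real (k n)"
        using elim(1) kpos by (simp add: field_simps)
      also have "\<dots> \<le> (\<Sum>j = 1..k n. indicat_real (cball x e) (block_value X S n j \<omega>)) / real (k n)"
        using sub by (intro divide_right_mono sum_mono) auto
      also have "\<dots> = measure (empirical X S k \<omega> n) (cball x e)"
        using k_ge_1[OF elim(4)] by (simp add: measure_empirical)
      finally show ?case .
    qed
    then show ?case by (rule le_liminf_log_rateI)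
  qed
qed

lemma log_rate_completion_law:
  assumes "A \<in> sets borel"
  shows "log_rate (\<lambda>n. completion (law P X S n)) A = log_rate (law P X S) A"
  using assms by (simp add: log_rate_def law_def fun_eq_iff)

lemma borel_in_completed_field: "A \<in> sets borel \<Longrightarrow> A \<in> completed_field (law P X S)"
  by (auto simp: completed_field_def law_def intro: sets_completionI_sets)

lemma LDP_upper_cball:
  assumes "LDP (law P X S) I" and "ereal q < I x"
  obtains e where "e > 0" "limsup (log_rate (law P X S) (cball x e)) < ereal (- q)"
proof -
  obtain q' where q': "q < q'" "ereal q' < I x"
    using ereal_dense2[OF assms(2)] by auto
  obtain e where e: "e > 0" "ereal q' \<le> (INF y\<in>cball x e. I y)"
    using rate_function_cball[of I q' x] assms(1) q'(2) by (auto simp: LDP_def)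
  have "cball x e \<in> sets borel" by simp
  then have "limsup (log_rate (law P X S) (cball x e)) \<le> - (INF y\<in>closure (cball x e). I y)"
    using assms(1) borel_in_completed_field[of "cball x e"] log_rate_completion_law[of "cball x e"]
    unfolding LDP_def by metis
  also have "\<dots> \<le> - ereal q'"
    using e(2) by (simp only: closure_closed[OF closed_cball] ereal_minus_le_minus)
  also have "\<dots> < ereal (- q)" using q'(1) by simp
  finally show ?thesis using that e(1) by blast
qed

lemma LDP_lower_cball:
  assumes "LDP (law P X S) I" and "I x < ereal q" and "e > 0"
  shows "ereal (- q) < liminf (log_rate (law P X S) (cball x e))"
proof -
  have "ereal (- q) < - I x"
    using assms(2) by (metis ereal_minus_less_minus uminus_ereal.simps(1))
  also have "\<dots> \<le> - (INF y\<in>interior (cball x e). I y)"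
  proof -
    have "x \<in> interior (cball x e)"
      using \<open>e > 0\<close> ball_subset_cball by (intro interiorI[of "ball x e"]) auto
    then show ?thesis by (auto intro: INF_lower)
  qed
  also have "\<dots> \<le> liminf (log_rate (law P X S) (cball x e))"
    using assms(1) borel_in_completed_field[of "cball x e"] log_rate_completion_law[of "cball x e"]
    unfolding LDP_def by (metis borel_closed closed_cball)
  finally show ?thesis .
qed

lemma limsup_log_rate_empirical_cball_mono:
  "e \<le> e' \<Longrightarrow> limsup (log_rate (empirical X S k \<omega>) (cball x e)) \<le> limsup (log_rate (empirical X S k \<omega>) (cball x e'))"
  by (intro Limsup_mono eventually_ge_1_imp log_rate_empirical_mono k_ge_1) auto

lemma liminf_log_rate_empirical_cball_mono:
  "e \<le> e' \<Longrightarrow> liminf (log_rate (empirical X S k \<omega>) (cball x e)) \<le> liminf (log_rate (empirical X S k \<omega>) (cball x e'))"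
  by (intro Liminf_mono eventually_ge_1_imp log_rate_empirical_mono k_ge_1) auto

text \<open>
  Lower semicontinuity of \<open>I\<close> turns the upper bounds for small balls into the local bound \<open>- I x\<close>.
  Rational levels suffice, which makes the exceptional null set independent of the level.
\<close>

lemma AE_empirical_local_upper:
  assumes "LDP (law P X S) I"
  shows "AE \<omega> in P. \<forall>a > - I x. \<forall>\<^sub>F e in at_right 0. limsup (log_rate (empirical X S k \<omega>) (cball x e)) < a"
proof -
  have "AE \<omega> in P. \<exists>e>0. limsup (log_rate (empirical X S k \<omega>) (cball x e)) \<le> ereal (- q)"
    if q: "ereal q < I x" for q
  proof -
    obtain e where e: "e > 0" "limsup (log_rate (law P X S) (cball x e)) < ereal (- q)"
      using LDP_upper_cball[OF assms q] by blast
    have "AE \<omega> in P. limsup (log_rate (empirical X S k \<omega>) (cball x e)) \<le> ereal (- q)"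
      using e(2) by (intro limsup_log_rate_empirical_le) auto
    then show ?thesis using e(1) by auto
  qed
  then have "AE \<omega> in P. \<forall>q\<in>{q \<in> \<rat>. ereal q < I x}.
      \<exists>e>0. limsup (log_rate (empirical X S k \<omega>) (cball x e)) \<le> ereal (- q)"
    by (subst AE_ball_countable) (auto intro: countable_subset[OF _ countable_rat])
  then show ?thesis
  proof eventually_elim
    case (elim \<omega>)
    show ?case
    proof (intro allI impI)
      fix a assume "- I x < a"
      then have "- a < I x"
        by (metis ereal_minus_less_minus ereal_uminus_uminus)
      then obtain u v where uv: "- a < ereal u" "u < v" "ereal v < I x"
        by (metis ereal_dense2 ereal_less_eq(3) less_ereal.simps(1))
      then obtain q where q: "q \<in> \<rat>" "u < q" "q < v"
        using Rats_dense_in_real by blast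
      have "ereal q < I x" using q uv by (metis less_ereal.simps(1) order_less_trans)
      then obtain e where e: "e > 0" "limsup (log_rate (empirical X S k \<omega>) (cball x e)) \<le> ereal (- q)"
        using elim q by auto
      have "- a < ereal q" using q uv by (metis less_ereal.simps(1) order_less_trans)
      then have "ereal (- q) < a"
        by (metis ereal_minus_less_minus ereal_uminus_uminus uminus_ereal.simps(1))
      then have "limsup (log_rate (empirical X S k \<omega>) (cball x e')) < a" if "e' < e" for e'
        using e(2) limsup_log_rate_empirical_cball_mono[of e' e] that
        by (meson less_imp_le order.strict_trans1 order.trans)
      then show "\<forall>\<^sub>F e in at_right 0. limsup (log_rate (empirical X S k \<omega>) (cball x e)) < a"
        using e(1) unfolding eventually_at_right_field by blast
    qed
  qed
qed

lemma AE_empirical_local_lower: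
  fixes R :: "nat \<Rightarrow> (nat \<Rightarrow> 'e) \<Rightarrow> 'y"
  assumes LDP: "LDP (law P X S) I"
    and moments: "\<And>h::real. h > 0 \<Longrightarrow> mixing_moment P E X h < \<infinity>"
    and R: "\<And>n. n \<ge> 1 \<Longrightarrow> R n \<in> measurable (seq_space E) borel"
    and R_dep: "\<And>n z z'. n \<ge> 1 \<Longrightarrow> z \<in> space (seq_space E) \<Longrightarrow> z' \<in> space (seq_space E) \<Longrightarrow>
      (\<forall>i\<in>{1..2 * n}. z i = z' i) \<Longrightarrow> R n z = R n z'"
    and approx: "(\<lambda>n. SUP z\<in>space (seq_space E). ereal (norm (S n z - R n z) / real n)) \<longlonglongrightarrow> 0"
    and k: "I x < liminf (\<lambda>n. ereal (ln (real (k n)) / real n))"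
  shows "AE \<omega> in P. \<forall>e>0. - I x \<le> liminf (log_rate (empirical X S k \<omega>) (cball x e))"
proof -
  have "0 \<le> I x" using LDP by (simp add: LDP_def rate_function_def)
  have lower: "AE \<omega> in P. ereal (- q) \<le> liminf (log_rate (empirical X S k \<omega>) (cball x e))"
    if q: "I x < ereal q" and "e > 0" for q e
  proof -
    \<comment> \<open>The rate \<open>r\<close> at which visits are guaranteed has to stay below the growth rate of the number of blocks.\<close>
    have "I x < min (ereal q) (liminf (\<lambda>n. ereal (ln (real (k n)) / real n)))"
      using q k by simp
    then obtain r where r: "I x < ereal r" "r < q" "ereal r < liminf (\<lambda>n. ereal (ln (real (k n)) / real n))"
      using ereal_dense2 by fastforce
    have "0 \<le> r"
      using \<open>0 \<le> I x\<close> r(1) by (metis ereal_less_eq(5) less_imp_le order_trans)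
    moreover have "ereal (- r) < liminf (log_rate (law P X S) (cball x (e / 2)))"
      using LDP r(1) \<open>e > 0\<close> by (intro LDP_lower_cball) auto
    ultimately show ?thesis
      using r \<open>e > 0\<close>
      by (intro liminf_log_rate_empirical_ge[OF moments R R_dep approx, of "e / 2" _ r]) auto
  qed
  have "AE \<omega> in P. \<forall>q\<in>{q \<in> \<rat>. I x < ereal q}. \<forall>e\<in>{e \<in> \<rat>. e > 0}.
      ereal (- q) \<le> liminf (log_rate (empirical X S k \<omega>) (cball x e))"
  proof -
    have "countable {q \<in> \<rat>. I x < ereal q}" "countable {e \<in> \<rat>. (e::real) > 0}"
      by (auto intro: countable_subset[OF _ countable_rat])
    then show ?thesis using lower by (intro AE_ball_countable') auto
  qed
  then show ?thesis
  proof eventually_elim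
    case (elim \<omega>)
    show ?case
    proof (intro allI impI)
      fix e :: real assume "e > 0"
      then obtain e' where e': "e' \<in> \<rat>" "0 < e'" "e' < e"
        using Rats_dense_in_real by blast
      show "- I x \<le> liminf (log_rate (empirical X S k \<omega>) (cball x e))"
      proof (rule ccontr)
        let ?L = "liminf (log_rate (empirical X S k \<omega>) (cball x e))"
        assume "\<not> - I x \<le> ?L"
        then have "I x < - ?L"
          by (metis ereal_minus_less_minus ereal_uminus_uminus not_le)
        then obtain u v where uv: "I x < ereal u" "u < v" "ereal v < - ?L"
          by (metis ereal_dense2 less_ereal.simps(1))
        then obtain q where q: "q \<in> \<rat>" "u < q" "q < v"
          using Rats_dense_in_real by blast
        have "I x < ereal q" using q uv by (metis less_ereal.simps(1) order_less_trans)
        then have "ereal (- q) \<le> liminf (log_rate (empirical X S k \<omega>) (cball x e'))"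
          using elim q e' by auto
        also have "\<dots> \<le> ?L"
          using e' by (intro liminf_log_rate_empirical_cball_mono) auto
        finally have "- ?L \<le> ereal q"
          by (metis ereal_minus_le_minus ereal_uminus_uminus uminus_ereal.simps(1))
        moreover have "ereal q < - ?L" using q uv by (metis less_ereal.simps(1) order_less_trans)
        ultimately show False by simp
      qed
    qed
  qed
qed

text \<open>
  If there are exponentially fewer blocks than the inverse probability of the ball, the union bound
  excludes that a block value falls into the ball for infinitely many \<open>n\<close>.
\<close>

lemma AE_eventually_no_visit:
  assumes LDP: "LDP (law P X S) I"
    and "limsup (\<lambda>n. ereal (ln (real (k n)) / real n)) < I x"
  shows "\<exists>e>0. AE \<omega> in P. \<forall>\<^sub>F n in sequentially. {j \<in> {1..k n}. block_value X S n j \<omega> \<in> cball x e} = {}"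
proof -
  obtain v where v: "limsup (\<lambda>n. ereal (ln (real (k n)) / real n)) < ereal v" "ereal v < I x"
    using ereal_dense2[OF assms(2)] by blast
  obtain u where u: "limsup (\<lambda>n. ereal (ln (real (k n)) / real n)) < ereal u" "ereal u < ereal v"
    using ereal_dense2[OF v(1)] by blast
  have uv: "limsup (\<lambda>n. ereal (ln (real (k n)) / real n)) < ereal u" "u < v" "ereal v < I x"
    using u v by auto
  obtain e where e: "e > 0" "limsup (log_rate (law P X S) (cball x e)) < ereal (- v)"
    using LDP_upper_cball[OF LDP uv(3)] by blast
  let ?A = "\<lambda>n j. {\<omega> \<in> space P. block_value X S n j \<omega> \<in> cball x e}"
  have "\<forall>\<^sub>F n in sequentially. (\<Union>j\<in>{1..k n}. ?A n j) \<in> events \<and>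
      prob (\<Union>j\<in>{1..k n}. ?A n j) \<le> 1 * exp (- real n * (v - u))"
    using limsup_log_rate_lessD[OF e(2)] Limsup_lessD[OF uv(1)] eventually_ge_at_top[of 1]
  proof eventually_elim
    case (elim n)
    have ev: "?A n j \<in> events" for j
      using elim(3) by (intro block_event) auto
    have "ln (real (k n)) \<le> real n * u"
      using elim(2,3) by (simp add: field_simps)
    then have kn: "real (k n) \<le> exp (real n * u)"
      using k_ge_1[OF elim(3)] by (metis exp_le_cancel_iff exp_ln of_nat_0_less_iff less_eq_Suc_le One_nat_def)
    have "prob (\<Union>j\<in>{1..k n}. ?A n j) \<le> (\<Sum>j\<in>{1..k n}. prob (?A n j))"
      using ev by (intro finite_measure_subadditive_finite) auto
    also have "\<dots> = real (k n) * measure (law P X S n) (cball x e)"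
      using elim(3) by (simp add: prob_block_event del: mem_cball)
    also have "\<dots> \<le> exp (real n * u) * exp (real n * - v)"
      using kn elim(1) by (intro mult_mono) auto
    also have "\<dots> = 1 * exp (- real n * (v - u))"
      by (simp add: exp_add[symmetric] algebra_simps)
    finally show ?case using ev by auto
  qed
  then have "AE \<omega> in P. \<forall>\<^sub>F n in sequentially. \<omega> \<notin> (\<Union>j\<in>{1..k n}. ?A n j)"
    using uv(2) by (intro AE_eventually_not_in_exp_small[where c = "v - u" and C = 1]) auto
  then have "AE \<omega> in P. \<forall>\<^sub>F n in sequentially. {j \<in> {1..k n}. block_value X S n j \<omega> \<in> cball x e} = {}"
    using AE_space
  proof eventually_elim
    case (elim \<omega>)
    show ?case
      using elim(1) by eventually_elim (use elim(2) in auto)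
  qed
  then show ?thesis using e(1) by blast
qed

lemma AE_exponentially_tight_empirical:
  assumes "exponentially_tight (law P X S)"
  shows "AE \<omega> in P. exponentially_tight (empirical X S k \<omega>)"
proof -
  \<comment> \<open>One unit of the rate is given up to obtain the strict inequality that Markov's inequality starts from.\<close>
  have "\<exists>K. compact K \<and> limsup (log_rate (law P X S) (- K)) \<le> - ereal (real i + 1)" for i :: nat
    using assms unfolding exponentially_tight_def by blast
  then obtain K where K: "\<And>i::nat. compact (K i)"
    "\<And>i. limsup (log_rate (law P X S) (- K i)) \<le> - ereal (real i + 1)"
    by metis
  have "AE \<omega> in P. limsup (log_rate (empirical X S k \<omega>) (- K i)) \<le> ereal (- real i)" for i
  proof (rule limsup_log_rate_empirical_le)
    show "- K i \<in> sets borel"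
      using K(1)[of i] by (auto intro!: borel_open simp: compact_imp_closed open_Compl)
    show "limsup (log_rate (law P X S) (- K i)) < ereal (- real i)"
      by (rule order.strict_trans1[OF K(2)]) simp
  qed
  then have "AE \<omega> in P. \<forall>i. limsup (log_rate (empirical X S k \<omega>) (- K i)) \<le> ereal (- real i)"
    by (simp add: AE_all_countable)
  then show ?thesis
  proof eventually_elim
    case (elim \<omega>)
    show ?case
      unfolding exponentially_tight_def
    proof
      fix \<alpha> :: real
      obtain i :: nat where "\<alpha> \<le> real i" using real_arch_simple by blast
      then have "ereal (- real i) \<le> - ereal \<alpha>" by simp
      then show "\<exists>K. compact K \<and> limsup (log_rate (empirical X S k \<omega>) (- K)) \<le> - ereal \<alpha>"
        by (intro exI[of _ "K i"] conjI K(1) order_trans[OF elim[rule_format]])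
    qed
  qed
qed

end

section \<open>Large deviations for the empirical measures\<close>

theorem theorem2p1:
  fixes P :: "'w measure" and E :: "'e measure"
    and X :: "nat \<Rightarrow> 'w \<Rightarrow> 'e"
    and S :: "nat \<Rightarrow> (nat \<Rightarrow> 'e) \<Rightarrow> 'y::real_normed_vector"
    and k :: "nat \<Rightarrow> nat"
    and I :: "'y \<Rightarrow> ereal"
  assumes "prob_space P"
    and "stationary_process P E X"
    and "\<And>n. n \<ge> 1 \<Longrightarrow> S n \<in> measurable (seq_space E) borel"
    and "\<And>n. n \<ge> 1 \<Longrightarrow> k n \<ge> 1"
    and "mono_on {1..} k"
    and "LDP (law P X S) I"
    and "\<And>h::real. h > 0 \<Longrightarrow> mixing_moment P E X h < \<infinity>"
    and "\<exists>R :: nat \<Rightarrow> (nat \<Rightarrow> 'e) \<Rightarrow> 'y.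
           (\<forall>n\<ge>1. R n \<in> measurable (seq_space E) borel) \<and>
           (\<forall>n\<ge>1. \<forall>z\<in>space (seq_space E). \<forall>z'\<in>space (seq_space E).
              (\<forall>i\<in>{1..2 * n}. z i = z' i) \<longrightarrow> R n z = R n z') \<and>
           (\<lambda>n. SUP z\<in>space (seq_space E). ereal (norm (S n z - R n z) / real n)) \<longlonglongrightarrow> 0"
  shows
    "(\<forall>x\<in>effective_domain I.
        (liminf (\<lambda>n. ereal (ln (real (k n)) / real n)) > I x \<longrightarrow>
          (AE \<omega> in P.
             ((\<lambda>\<epsilon>. liminf (log_rate (empirical X S k \<omega>) (cball x \<epsilon>))) \<longlongrightarrow> - I x) (at_right 0) \<and>
             ((\<lambda>\<epsilon>. limsup (log_rate (empirical X S k \<omega>) (cball x \<epsilon>))) \<longlongrightarrow> - I x) (at_right 0))) \<and>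
        (limsup (\<lambda>n. ereal (ln (real (k n)) / real n)) < I x \<longrightarrow>
          (\<exists>\<epsilon>>0. AE \<omega> in P. \<forall>\<^sub>F n in sequentially.
             {j \<in> {1..k n}. block_value X S n j \<omega> \<in> cball x \<epsilon>} = {})))
     \<and>
     (\<forall>x. x \<notin> effective_domain I \<longrightarrow>
        (AE \<omega> in P.
           ((\<lambda>\<epsilon>. limsup (log_rate (empirical X S k \<omega>) (cball x \<epsilon>))) \<longlongrightarrow> - I x) (at_right 0) \<and>
           - I x = - \<infinity>))
     \<and>
     (exponentially_tight (law P X S) \<longrightarrow>
        (AE \<omega> in P. exponentially_tight (empirical X S k \<omega>)))"
proof -
  interpret prob_space P by fact
  interpret stationary_blocks P E X S k
    by unfold_locales (use assms(2-4) in auto)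
  from assms(8) obtain R :: "nat \<Rightarrow> (nat \<Rightarrow> 'e) \<Rightarrow> 'y" where
    R: "\<forall>n\<ge>1. R n \<in> measurable (seq_space E) borel"
      "\<forall>n\<ge>1. \<forall>z\<in>space (seq_space E). \<forall>z'\<in>space (seq_space E).
        (\<forall>i\<in>{1..2 * n}. z i = z' i) \<longrightarrow> R n z = R n z'"
    and approx: "(\<lambda>n. SUP z\<in>space (seq_space E). ereal (norm (S n z - R n z) / real n)) \<longlonglongrightarrow> 0"
    by (elim exE conjE) (rule that)
  have measurable_R: "R n \<in> measurable (seq_space E) borel" if "n \<ge> 1" for n
    using R(1) that by blast
  have R_dep: "R n z = R n z'" if "n \<ge> 1" "z \<in> space (seq_space E)" "z' \<in> space (seq_space E)"
    "\<forall>i\<in>{1..2 * n}. z i = z' i" for n z z'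
    using R(2) that by blast
  let ?lsup = "\<lambda>\<omega> x e. limsup (log_rate (empirical X S k \<omega>) (cball x e))"
  let ?linf = "\<lambda>\<omega> x e. liminf (log_rate (empirical X S k \<omega>) (cball x e))"
  have local: "AE \<omega> in P. (?linf \<omega> x \<longlongrightarrow> - I x) (at_right 0) \<and> (?lsup \<omega> x \<longlongrightarrow> - I x) (at_right 0)"
    if k_large: "I x < liminf (\<lambda>n. ereal (ln (real (k n)) / real n))" for x
  proof -
    have "AE \<omega> in P. \<forall>e>0. - I x \<le> ?linf \<omega> x e"
      by (rule AE_empirical_local_lower[OF assms(6)]) (fact assms(7) measurable_R R_dep approx k_large)+
    then show ?thesis
      using AE_empirical_local_upper[OF assms(6), of x]
    proof eventually_elim
      case (elim \<omega>)
      have pos: "\<forall>\<^sub>F e in at_right (0::real). 0 < e"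
        by (simp add: eventually_at_right_less)
      have le: "?linf \<omega> x e \<le> ?lsup \<omega> x e" for e
        by (intro Liminf_le_Limsup) simp
      have "(?linf \<omega> x \<longlongrightarrow> - I x) (at_right 0)"
      proof (rule order_tendstoI)
        fix a assume "a < - I x"
        show "\<forall>\<^sub>F e in at_right 0. a < ?linf \<omega> x e"
          using pos by eventually_elim (use elim(1) \<open>a < - I x\<close> in \<open>meson order.strict_trans2\<close>)
      next
        fix a assume "- I x < a"
        then have "\<forall>\<^sub>F e in at_right 0. ?lsup \<omega> x e < a" using elim(2) by blast
        then show "\<forall>\<^sub>F e in at_right 0. ?linf \<omega> x e < a"
          by eventually_elim (use le in \<open>meson order.strict_trans1\<close>)
      qed
      moreover have "(?lsup \<omega> x \<longlongrightarrow> - I x) (at_right 0)"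
      proof (rule order_tendstoI)
        fix a assume "a < - I x"
        show "\<forall>\<^sub>F e in at_right 0. a < ?lsup \<omega> x e"
          using pos by eventually_elim (use elim(1) le \<open>a < - I x\<close> in \<open>meson order.strict_trans2\<close>)
      qed (use elim(2) in blast)
      ultimately show ?case by blast
    qed
  qed
  have outside: "AE \<omega> in P. (?lsup \<omega> x \<longlongrightarrow> - I x) (at_right 0) \<and> - I x = - \<infinity>"
    if "x \<notin> effective_domain I" for x
    using AE_empirical_local_upper[OF assms(6), of x]
  proof eventually_elim
    case (elim \<omega>)
    have "I x = \<infinity>" using that by (simp add: effective_domain_def)
    then show ?case
      using elim by (auto intro!: order_tendstoI)
  qed
  show ?thesis
    using local outside AE_eventually_no_visit[OF assms(6)] AE_exponentially_tight_empirical by blast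
qed

end
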